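(* Let $\omega:[0,\infty)\to\mathbb{R}^3$ be a continuous function, and let $K,L,M\in\mathbb{R}^{3\times3}$ be constant matrices whose symmetric parts $\frac{K+K^T}{2},\frac{L+L^T}{2},\frac{M+M^T}{2}$ are positive definite. Then the equilibrium point $(\bar e_v,\bar e_\gamma,\bar e_\beta)=(0,0,0)$ of the (time-varying) system on $\mathbb{R}^3\times\mathbb{R}^3\times\mathbb{R}^3$ $$\dot e_v = e_v\times\omega(t) + e_\gamma - K e_v,\qquad \dot e_\gamma = e_\gamma\times\omega(t) - L e_\gamma,\qquad \dot e_\beta = e_\beta\times\omega(t) - M e_\beta$$ is globally exponentially stable.
   Context: Here $\times$ is the cross product on $\mathbb{R}^3$ and $|\cdot|$ is the Euclidean norm. The origin of a time-varying system $\dot e=f(t,e)$ is globally exponentially stable if there are constants $c,\lambda>0$ such that for every initial time $t_0\ge0$ and every initial condition $e(t_0)$, the solution satisfies $|e(t)|\le c\,e^{-\lambda(t-t_0)}|e(t_0)|$ for all $t\ge t_0$. Origin of the system (for information; not needed to understand the claim). Consider a rigid body with $\dot v=v\times\omega+\gamma+a$, $\dot\gamma=\gamma\times\omega$, $\dot\beta=\beta\times\omega$, where $v,\omega,a,\beta$ are perfectly measured. Consider also the observer $\dot{\hat v}=\hat v\times\omega+a+\hat\gamma-(L+K)(\hat v-v)$, $\dot{\hat\gamma}=\hat\gamma\times\omega-(LS(\omega)-S(\omega)L+LK)(\hat v-v)$, $\dot{\hat\beta}=\hat\beta\times\omega-M(\hat\beta-\beta)$, where $S(\omega)x=\omega\times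 x$. The system above is the dynamics of the error variables $e_v=\hat v-v$, $e_\gamma=\hat\gamma-\gamma-Le_v$, $e_\beta=\hat\beta-\beta$. *)

theory Defs
  imports "HOL-Analysis.Analysis"
begin

definition sym_part :: "real^'n^'n \<Rightarrow> real^'n^'n" where
  "sym_part A = (1/2) *\<^sub>R (A + transpose A)"

definition positive_definite :: "real^'n^'n \<Rightarrow> bool" where
  "positive_definite A \<longleftrightarrow> transpose A = A \<and> (\<forall>x. x \<noteq> 0 \<longrightarrow> x \<bullet> (A *v x) > 0)"

text \<open>Derivatives are taken within \<open>I\<close>, hence are one-sided at the endpoints of an interval.\<close>

definition is_solution_on ::
  "(real \<Rightarrow> 'a \<Rightarrow> 'a) \<Rightarrow> real set \<Rightarrow> (real \<Rightarrow> 'a::real_normed_vector) \<Rightarrow> bool" where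
  "is_solution_on f I e \<longleftrightarrow> (\<forall>t\<in>I. (e has_vector_derivative f t (e t)) (at t within I))"

text \<open>The solution of an initial value problem, defined for all \<open>t \<ge> t0\<close>. Uniqueness is required
  on every compact interval starting at \<open>t0\<close>, so that no other solution, not even one that
  exists for a finite time only, branches off; values before \<open>t0\<close> are irrelevant.\<close>

definition is_the_solution ::
  "(real \<Rightarrow> 'a \<Rightarrow> 'a) \<Rightarrow> real \<Rightarrow> 'a \<Rightarrow> (real \<Rightarrow> 'a::real_normed_vector) \<Rightarrow> bool" where
  "is_the_solution f t0 x0 e \<longleftrightarrow>
     is_solution_on f {t0..} e \<and> e t0 = x0 \<and>
     (\<forall>T\<ge>t0. \<forall>e'. is_solution_on f {t0..T} e' \<and> e' t0 = x0 \<longrightarrow> (\<forall>t\<in>{t0..T}. e' t = e t))"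

text \<open>Global exponential stability of the origin of \<open>e' = f(t, e)\<close>. The existence of a unique
  solution on \<open>[t0, \<infinity>)\<close> is part of the requirement. That the origin is an equilibrium
  is implied by the case \<open>x0 = 0\<close>.\<close>

definition globally_exponentially_stable ::
  "(real \<Rightarrow> 'a::real_normed_vector \<Rightarrow> 'a) \<Rightarrow> bool" where
  "globally_exponentially_stable f \<longleftrightarrow>
     (\<exists>c>0. \<exists>\<alpha>>0. \<forall>t0\<ge>0. \<forall>x0. \<exists>e. is_the_solution f t0 x0 e \<and>
        (\<forall>t\<ge>t0. norm (e t) \<le> c * exp (- \<alpha> * (t - t0)) * norm (e t0)))"

text \<open>The norm on the product type is the Euclidean one
  (\<open>norm (x, y) = sqrt ((norm x)\<^sup>2 + (norm y)\<^sup>2)\<close>), so the state space below is Euclidean 9-space.\<close>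

definition error_system ::
  "(real \<Rightarrow> real^3) \<Rightarrow> real^3^3 \<Rightarrow> real^3^3 \<Rightarrow> real^3^3 \<Rightarrow>
   real \<Rightarrow> (real^3) \<times> (real^3) \<times> (real^3) \<Rightarrow> (real^3) \<times> (real^3) \<times> (real^3)" where
  "error_system \<omega> K L M t = (\<lambda>(e\<^sub>v, e\<^sub>\<gamma>, e\<^sub>\<beta>).
     (cross3 e\<^sub>v (\<omega> t) + e\<^sub>\<gamma> - K *v e\<^sub>v,
      cross3 e\<^sub>\<gamma> (\<omega> t) - L *v e\<^sub>\<gamma>,
      cross3 e\<^sub>\<beta> (\<omega> t) - M *v e\<^sub>\<beta>))"

end

theory Submission
  imports Defs
begin

text \<open>The rotation terms do no work, since \<open>x \<bullet> (x \<times> \<omega>) = 0\<close>. Let \<open>\<mu>\<close> be a common coercivity constant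
  of \<open>K\<close>, \<open>L\<close>, \<open>M\<close> and \<open>s = 1 + 1/\<mu>\<close>. The coupling \<open>e\<^sub>v \<bullet> e\<^sub>\<gamma>\<close> is absorbed by weighting \<open>e\<^sub>\<gamma>\<close> with \<open>s\<close>:
  as \<open>s\<mu> \<ge> 1\<close>, \<open>V = |e\<^sub>v|\<^sup>2 + s\<^sup>2|e\<^sub>\<gamma>|\<^sup>2 + |e\<^sub>\<beta>|\<^sup>2\<close> satisfies \<open>V' \<le> -\<mu> V\<close> along every solution.
  Existence of global solutions of the linear system is shown by the Picard series, and
  uniqueness follows from the decay estimate for the difference of two solutions.\<close>

subsection \<open>Linear differential equations\<close>

text \<open>The terms of the Peano-Baker series for \<open>e' = A t e\<close>: their sum up to index
  \<open>n\<close> is the \<open>n\<close>-th Picard iterate started at the constant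
  \<open>x0\<close>. Since the equation is linear, each term is an integral of the previous one
  alone.\<close>

fun picard_term :: "(real \<Rightarrow> 'a::banach \<Rightarrow>\<^sub>L 'a) \<Rightarrow> real \<Rightarrow> 'a \<Rightarrow> nat \<Rightarrow> real \<Rightarrow> 'a" where
  "picard_term A t0 x0 0 t = x0"
| "picard_term A t0 x0 (Suc n) t = integral {t0..t} (\<lambda>s. A s (picard_term A t0 x0 n s))"

lemma picard_term_continuous_on:
  assumes "continuous_on {t0..T} A"
  shows "continuous_on {t0..T} (picard_term A t0 x0 n)"
proof (induction n)
  case (Suc n)
  have "continuous_on {t0..T} (\<lambda>s. A s (picard_term A t0 x0 n s))"
    by (intro continuous_intros assms Suc)
  then show ?case
    by (auto intro!: indefinite_integral_continuous_1 integrable_continuous_real)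
qed simp

lemma picard_term_Suc_has_vector_derivative:
  assumes "continuous_on {t0..T} A" and "t \<in> {t0..T}"
  shows "(picard_term A t0 x0 (Suc n) has_vector_derivative A t (picard_term A t0 x0 n t))
    (at t within {t0..T})"
proof -
  have "continuous_on {t0..T} (\<lambda>s. A s (picard_term A t0 x0 n s))"
    by (intro continuous_intros assms(1) picard_term_continuous_on)
  from integral_has_vector_derivative[OF this assms(2)] show ?thesis
    by (simp add: picard_term.simps[abs_def])
qed

text \<open>Induction on \<open>n\<close>: the bound for \<open>Suc n\<close> vanishes at
  \<open>t0\<close> and has derivative \<open>B\<close> times the bound for \<open>n\<close>, so
  integrating the estimate reproduces it. The bounds are the terms of an exponential series, hence
  summable.\<close>

lemma norm_picard_term_le:
  assumes "continuous_on {t0..T} A" and bound: "\<And>t. t \<in> {t0..T} \<Longrightarrow> norm (A t) \<le> B"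
    and "t \<in> {t0..T}"
  shows "norm (picard_term A t0 x0 n t) \<le> norm x0 * (B * (t - t0)) ^ n / fact n"
  using assms(3)
proof (induction n arbitrary: t)
  case (Suc n)
  have "0 \<le> B"
    using bound[OF Suc.prems] norm_ge_zero order_trans by blast
  let ?g = "\<lambda>s. norm x0 * (B * (s - t0)) ^ Suc n / fact (Suc n)"
  let ?g' = "\<lambda>s. B * (norm x0 * (B * (s - t0)) ^ n / fact n)"
  have "(?g has_vector_derivative ?g' s) (at s within {t0..t})" for s
  proof -
    have "(?g has_real_derivative
        norm x0 * (of_nat (Suc n) * (B * (s - t0)) ^ n * B) / fact (Suc n)) (at s within {t0..t})"
      by (rule derivative_eq_intros refl | simp)+
    also have "norm x0 * (of_nat (Suc n) * (B * (s - t0)) ^ n * B) / fact (Suc n) = ?g' s"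
      by (simp add: divide_simps del: of_nat_Suc)
    finally show ?thesis
      by (simp add: has_real_derivative_iff_has_vector_derivative)
  qed
  then have g: "(?g' has_integral (?g t - ?g t0)) {t0..t}"
    using Suc.prems by (intro fundamental_theorem_of_calculus) auto
  have "norm (A s (picard_term A t0 x0 n s)) \<le> ?g' s" if "s \<in> {t0..t}" for s
  proof -
    have s: "s \<in> {t0..T}"
      using that Suc.prems by auto
    show ?thesis
      using bound[OF s] Suc.IH[OF s] \<open>0 \<le> B\<close>
      by (intro order_trans[OF norm_blinfun] mult_mono) auto
  qed
  moreover have "continuous_on {t0..t} (\<lambda>s. A s (picard_term A t0 x0 n s))"
    by (rule continuous_on_subset[of "{t0..T}"])
      (use Suc.prems in \<open>auto intro!: continuous_intros assms picard_term_continuous_on\<close>)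
  ultimately have "norm (integral {t0..t} (\<lambda>s. A s (picard_term A t0 x0 n s))) \<le> integral {t0..t} ?g'"
    by (intro integral_norm_bound_integral integrable_continuous_real has_integral_integrable[OF g])
  also have "\<dots> = ?g t"
    using integral_unique[OF g] by simp
  finally show ?case
    by simp
qed simp

text \<open>Termwise differentiation: the derivative of each term is \<open>A t\<close> applied to
  its predecessor, so the differentiated series is \<open>A t\<close> applied to the series itself.
  Boundedness of \<open>A\<close> on the compact interval makes both converge uniformly.\<close>

lemma linear_ode_exists_compact:
  fixes A :: "real \<Rightarrow> 'a::banach \<Rightarrow>\<^sub>L 'a"
  assumes A: "continuous_on {t0..T} A" and "t0 \<le> T"
  shows "is_solution_on (\<lambda>t. A t) {t0..T} (\<lambda>t. \<Sum>n. picard_term A t0 x0 n t)"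
proof -
  let ?u = "picard_term A t0 x0"
  let ?I = "{t0..T}"
  have "bounded (A ` ?I)"
    by (intro compact_imp_bounded compact_continuous_image A compact_Icc)
  then obtain B where "0 < B" and B: "\<And>t. t \<in> ?I \<Longrightarrow> norm (A t) \<le> B"
    by (auto simp: bounded_pos)
  define m where "m n = norm x0 * (B * (T - t0)) ^ n / fact n" for n
  have le_m: "norm (?u n t) \<le> m n" if "t \<in> ?I" for n t
  proof -
    have "norm (?u n t) \<le> norm x0 * (B * (t - t0)) ^ n / fact n"
      by (rule norm_picard_term_le[OF A B that])
    also have "\<dots> \<le> m n"
      unfolding m_def using that \<open>0 < B\<close>
      by (intro divide_right_mono mult_left_mono power_mono) auto
    finally show ?thesis .
  qed
  have "summable m"
    unfolding m_def using summable_mult[OF summable_exp[of "B * (T - t0)"], of "norm x0"]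
    by (simp add: field_simps)
  have summable_u: "summable (\<lambda>n. ?u n t)" if "t \<in> ?I" for t
    using \<open>summable m\<close> le_m[OF that] by (rule summable_comparison_test')
  have unif: "uniform_limit ?I (\<lambda>n t. \<Sum>i<n. ?u i t) (\<lambda>t. \<Sum>i. ?u i t) sequentially"
    using le_m \<open>summable m\<close> by (intro Weierstrass_m_test) auto
  \<comment> \<open>\<open>u' n\<close> is the derivative of the \<open>n\<close>-th term; the
    constant initial term contributes 0.\<close>
  define u' where "u' n t = (case n of 0 \<Rightarrow> 0 | Suc k \<Rightarrow> A t (?u k t))" for n t
  have u': "(?u n has_derivative (\<lambda>h. h *\<^sub>R u' n t)) (at t within ?I)" if "t \<in> ?I" for n t
  proof (cases n)
    case 0
    then show ?thesis
      by (simp add: u'_def picard_term.simps(1)[abs_def])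
  next
    case (Suc k)
    then show ?thesis
      using picard_term_Suc_has_vector_derivative[OF A that, of x0 k]
      by (simp add: u'_def has_vector_derivative_def)
  qed
  \<comment> \<open>The index shift: differentiating \<open>Suc n\<close> terms yields
    \<open>A t\<close> applied to only \<open>n\<close> terms.\<close>
  have u'_sum: "(\<Sum>i<Suc n. u' i t) = A t (\<Sum>i<n. ?u i t)" for n t
    by (simp only: sum.lessThan_Suc_shift) (simp add: u'_def blinfun.sum_right)
  have "\<exists>g. \<forall>t\<in>?I. (\<lambda>n. ?u n t) sums g t \<and>
      (g has_derivative (\<lambda>h. h *\<^sub>R A t (\<Sum>i. ?u i t))) (at t within ?I)"
  proof (rule has_derivative_series[where f' = "\<lambda>n t h. h *\<^sub>R u' n t" and x = t0])
    fix e :: real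
    assume "0 < e"
    \<comment> \<open>The tolerance \<open>e / B\<close> becomes \<open>e\<close> after applying
      \<open>A t\<close>, whose operator norm is at most \<open>B\<close>.\<close>
    then have "\<forall>\<^sub>F n in sequentially. \<forall>t\<in>?I. dist (\<Sum>i<n. ?u i t) (\<Sum>i. ?u i t) < e / B"
      using unif \<open>0 < B\<close> by (intro uniform_limitD) auto
    then have "\<forall>\<^sub>F n in sequentially. \<forall>t\<in>?I. \<forall>h.
        norm ((\<Sum>i<Suc n. h *\<^sub>R u' i t) - h *\<^sub>R A t (\<Sum>i. ?u i t)) \<le> e * norm h"
    proof (rule eventually_mono, intro ballI allI)
      fix n t h
      assume *: "\<forall>t\<in>?I. dist (\<Sum>i<n. ?u i t) (\<Sum>i. ?u i t) < e / B" and t: "t \<in> ?I"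
      let ?d = "(\<Sum>i<n. ?u i t) - (\<Sum>i. ?u i t)"
      have "(\<Sum>i<Suc n. h *\<^sub>R u' i t) - h *\<^sub>R A t (\<Sum>i. ?u i t) = h *\<^sub>R A t ?d"
        unfolding scaleR_sum_right[symmetric] u'_sum
        by (simp add: blinfun.diff_right scaleR_diff_right)
      moreover have "norm (A t ?d) \<le> B * (e / B)"
        using * t B[OF t] \<open>0 < B\<close>
        by (intro order_trans[OF norm_blinfun] mult_mono) (auto simp: dist_norm less_imp_le)
      ultimately show
        "norm ((\<Sum>i<Suc n. h *\<^sub>R u' i t) - h *\<^sub>R A t (\<Sum>i. ?u i t)) \<le> e * norm h"
        using \<open>0 < B\<close> mult_left_mono[of "norm (A t ?d)" e "norm h"]
        by (simp add: mult.commute del: sum.lessThan_Suc)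
    qed
    then show "\<forall>\<^sub>F n in sequentially. \<forall>t\<in>?I. \<forall>h.
        norm ((\<Sum>i<n. h *\<^sub>R u' i t) - h *\<^sub>R A t (\<Sum>i. ?u i t)) \<le> e * norm h"
      by (rule eventually_sequentially_Suc[THEN iffD1])
  qed (use u' summable_u \<open>t0 \<le> T\<close> in \<open>auto intro: summable_sums\<close>)
  then obtain g where g: "\<And>t. t \<in> ?I \<Longrightarrow> (\<lambda>n. ?u n t) sums g t"
      "\<And>t. t \<in> ?I \<Longrightarrow> (g has_derivative (\<lambda>h. h *\<^sub>R A t (\<Sum>i. ?u i t))) (at t within ?I)"
    by blast
  \<comment> \<open>The limit \<open>g\<close> is known only through its values on the interval,
    where it equals the series by uniqueness of sums; its derivative carries over.\<close>
  show ?thesis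
    unfolding is_solution_on_def has_vector_derivative_def
    by (auto intro!: has_derivative_transform[OF _ _ g(2)] simp: sums_unique[OF g(1)])
qed

text \<open>The formula for the series does not mention the right endpoint, so the solutions on
  compact intervals are restrictions of one function and no gluing arises.\<close>

lemma linear_ode_exists:
  fixes A :: "real \<Rightarrow> 'a::banach \<Rightarrow>\<^sub>L 'a"
  assumes A: "continuous_on {t0..} A"
  obtains e where "is_solution_on (\<lambda>t. A t) {t0..} e" and "e t0 = x0"
proof
  let ?e = "\<lambda>t. \<Sum>n. picard_term A t0 x0 n t"
  show "is_solution_on (\<lambda>t. A t) {t0..} ?e"
    unfolding is_solution_on_def
  proof
    fix t
    assume t: "t \<in> {t0..}"
    \<comment> \<open>Ending the interval beyond \<open>t\<close> makes the derivative within it the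
      same as the derivative within \<open>{t0..}\<close>.\<close>
    have "continuous_on {t0..t + 1} A"
      by (rule continuous_on_subset[OF A]) auto
    then have "(?e has_vector_derivative A t (?e t)) (at t within {t0..t + 1})"
      using linear_ode_exists_compact[of t0 "t + 1" A x0] t by (auto simp: is_solution_on_def)
    moreover have "at t within {t0..t + 1} = at t within {t0..}"
      by (rule at_within_nhd[of _ "{..<t + 1}"]) auto
    ultimately show "(?e has_vector_derivative A t (?e t)) (at t within {t0..})"
      by simp
  qed
  have "picard_term A t0 x0 n t0 = (if n = 0 then x0 else 0)" for n
    by (cases n) auto
  then show "?e t0 = x0"
    using suminf_finite[of "{0}" "\<lambda>n. picard_term A t0 x0 n t0"] by simp
qed

lemma is_solution_on_subset:
  "is_solution_on f I e \<Longrightarrow> J \<subseteq> I \<Longrightarrow> is_solution_on f J e"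
  unfolding is_solution_on_def by (blast intro: has_vector_derivative_within_subset)

lemma is_solution_on_diff:
  assumes "\<And>t. linear (f t)" and "is_solution_on f I d" and "is_solution_on f I e"
  shows "is_solution_on f I (\<lambda>t. d t - e t)"
  using assms(2,3) unfolding is_solution_on_def
  by (simp add: linear_diff[OF assms(1)] has_vector_derivative_diff)

subsection \<open>Quadratic Lyapunov functions\<close>

text \<open>Gronwall's argument: after multiplication by the integrating factor
  \<open>exp (\<alpha> * (t - t0))\<close> the derivative is nonpositive.\<close>

lemma exp_decay_of_deriv_le:
  fixes V :: "real \<Rightarrow> real"
  assumes V: "\<And>t. t \<in> {t0..T} \<Longrightarrow> (V has_real_derivative V' t) (at t within {t0..T})"
    and le: "\<And>t. t \<in> {t0..T} \<Longrightarrow> V' t \<le> - \<alpha> * V t"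
    and "t0 \<le> T"
  shows "V T \<le> exp (- \<alpha> * (T - t0)) * V t0"
proof -
  let ?W = "\<lambda>t. exp (\<alpha> * (t - t0)) * V t"
  have W: "(?W has_real_derivative exp (\<alpha> * (t - t0)) * (\<alpha> * V t + V' t)) (at t within {t0..T})"
    if "t \<in> {t0..T}" for t
    by (rule derivative_eq_intros V that refl)+ (simp add: algebra_simps)
  have "?W T \<le> ?W t0"
  proof (rule DERIV_nonpos_imp_decreasing_open[OF \<open>t0 \<le> T\<close>])
    show "continuous_on {t0..T} ?W"
      using W by (rule DERIV_continuous_on)
    fix t
    assume t: "t0 < t" "t < T"
    then have "exp (\<alpha> * (t - t0)) * (\<alpha> * V t + V' t) \<le> 0"
      using le[of t] by (intro mult_nonneg_nonpos) auto
    \<comment> \<open>At interior points the derivative within the interval is the two-sided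
      one.\<close>
    then show "\<exists>y. (?W has_real_derivative y) (at t) \<and> y \<le> 0"
      using W[of t] t at_within_Icc_at[OF t] by auto
  qed
  then have "exp (- (\<alpha> * (T - t0))) * ?W T \<le> exp (- (\<alpha> * (T - t0))) * V t0"
    by (intro mult_left_mono) auto
  then show ?thesis
    by (simp add: mult.assoc[symmetric] exp_add[symmetric])
qed

text \<open>Along a solution the squared norm of \<open>G (e t)\<close> has derivative
  \<open>2 * (G (e t) \<bullet> G (f t (e t)))\<close>, so it decays at rate
  \<open>2 * \<alpha>\<close>; the square root decays at rate \<alpha>.\<close>

lemma norm_decay_of_lyapunov:
  fixes G :: "'a::real_normed_vector \<Rightarrow> 'b::real_inner"
  assumes G: "bounded_linear G"
    and le: "\<And>t x. G x \<bullet> G (f t x) \<le> - \<alpha> * (norm (G x))\<^sup>2"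
    and e: "is_solution_on f {t0..T} e" and "t0 \<le> T"
  shows "norm (G (e T)) \<le> exp (- \<alpha> * (T - t0)) * norm (G (e t0))"
proof -
  have "(norm (G (e T)))\<^sup>2 \<le> exp (- (2 * \<alpha>) * (T - t0)) * (norm (G (e t0)))\<^sup>2"
  proof (rule exp_decay_of_deriv_le[OF _ _ \<open>t0 \<le> T\<close>])
    fix t
    assume "t \<in> {t0..T}"
    then have "((\<lambda>t. G (e t)) has_vector_derivative G (f t (e t))) (at t within {t0..T})"
      using e by (intro bounded_linear.has_vector_derivative[OF G]) (auto simp: is_solution_on_def)
    from bounded_bilinear.has_vector_derivative[OF bounded_bilinear_inner this this]
    show "((\<lambda>t. (norm (G (e t)))\<^sup>2) has_real_derivative 2 * (G (e t) \<bullet> G (f t (e t))))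
        (at t within {t0..T})"
      by (simp add: has_real_derivative_iff_has_vector_derivative power2_norm_eq_inner inner_commute)
    show "2 * (G (e t) \<bullet> G (f t (e t))) \<le> - (2 * \<alpha>) * (norm (G (e t)))\<^sup>2"
      using le[of "e t" t] by simp
  qed
  also have "\<dots> = (exp (- \<alpha> * (T - t0)) * norm (G (e t0)))\<^sup>2"
    by (simp add: power_mult_distrib exp_double[symmetric] algebra_simps)
  finally show ?thesis
    by (rule power2_le_imp_le) simp
qed

text \<open>The Lyapunov function is the squared norm of \<open>G x\<close>. The two-sided
  comparison of \<open>norm (G x)\<close> with \<open>norm x\<close> transfers its decay to the
  state, at the price of the factor \<open>c\<close>.\<close>

lemma globally_exponentially_stable_of_lyapunov:
  fixes f :: "real \<Rightarrow> 'a::euclidean_space \<Rightarrow> 'a" and G :: "'a \<Rightarrow> 'b::real_inner"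
  assumes lin: "\<And>t. linear (f t)"
    and cont: "\<And>x. continuous_on {0..} (\<lambda>t. f t x)"
    and G: "bounded_linear G"
    and lower: "\<And>x. norm x \<le> norm (G x)" and upper: "\<And>x. norm (G x) \<le> c * norm x" and "0 < c"
    and le: "\<And>t x. G x \<bullet> G (f t x) \<le> - \<alpha> * (norm (G x))\<^sup>2" and "0 < \<alpha>"
  shows "globally_exponentially_stable f"
proof -
  \<comment> \<open>Stated on a compact interval, so that it also covers differences with solutions
    that exist for a finite time only.\<close>
  have decay: "norm (e t) \<le> c * exp (- \<alpha> * (t - t0)) * norm (e t0)"
    if "is_solution_on f {t0..t} e" and "t0 \<le> t" for t0 t e
  proof -
    have "norm (e t) \<le> exp (- \<alpha> * (t - t0)) * norm (G (e t0))"
      using norm_decay_of_lyapunov[OF G le that] lower order_trans by blast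
    also have "\<dots> \<le> exp (- \<alpha> * (t - t0)) * (c * norm (e t0))"
      using upper by (intro mult_left_mono) auto
    finally show ?thesis
      by (simp add: mult_ac)
  qed
  define A where "A t = Blinfun (f t)" for t
  have A: "blinfun_apply (A t) = f t" for t
    unfolding A_def by (intro bounded_linear_Blinfun_apply linear_conv_bounded_linear[THEN iffD1] lin)
  have "\<exists>e. is_the_solution f t0 x0 e \<and>
      (\<forall>t\<ge>t0. norm (e t) \<le> c * exp (- \<alpha> * (t - t0)) * norm (e t0))" if "0 \<le> t0" for t0 x0
  proof -
    \<comment> \<open>In finite dimension, continuity of \<open>f t x\<close> in \<open>t\<close>
      for each fixed \<open>x\<close> gives continuity of \<open>A\<close> in operator norm.\<close>
    have "continuous_on {t0..} A"
      using that by (intro continuous_on_blinfun_componentwise)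
        (auto simp: A intro: continuous_on_subset[OF cont])
    then obtain e where e: "is_solution_on f {t0..} e" "e t0 = x0"
      by (rule linear_ode_exists[of t0 A x0, unfolded A])
    have "e' t = e t" if "is_solution_on f {t0..T} e'" "e' t0 = x0" "t \<in> {t0..T}" for T e' t
    proof -
      \<comment> \<open>The difference starts at 0, and the decay estimate then bounds its norm at
        \<open>t\<close> by 0.\<close>
      have "is_solution_on f {t0..t} (\<lambda>s. e' s - e s)"
        using that by (intro is_solution_on_diff lin)
          (auto intro: is_solution_on_subset[OF e(1)] is_solution_on_subset[OF that(1)])
      from decay[OF this] show ?thesis
        using that e(2) by simp
    qed
    moreover have "is_solution_on f {t0..t} e" for t
      by (rule is_solution_on_subset[OF e(1)]) auto
    ultimately show ?thesis
      using e decay unfolding is_the_solution_def by blast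
  qed
  then show ?thesis
    unfolding globally_exponentially_stable_def using \<open>0 < c\<close> \<open>0 < \<alpha>\<close> by blast
qed

subsection \<open>The error system\<close>

text \<open>A matrix and its transpose have the same quadratic form, so the antisymmetric part
  contributes nothing.\<close>

lemma inner_sym_part: "x \<bullet> (sym_part A *v x) = x \<bullet> (A *v x)"
proof -
  have "x \<bullet> (transpose A *v x) = x \<bullet> (A *v x)"
    by (metis dot_lmul_matrix inner_commute transpose_matrix_vector)
  then show ?thesis
    by (simp add: sym_part_def matrix_vector_mult_add_rdistrib inner_add_right
        scaleR_matrix_vector_assoc[symmetric])
qed

text \<open>The constant is the minimum of the quadratic form on the compact unit sphere;
  homogeneity of degree two extends the bound to all \<open>x\<close>.\<close>

lemma positive_definite_sym_part_coercive:
  fixes A :: "real^'n^'n"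
  assumes "positive_definite (sym_part A)"
  obtains \<mu> where "0 < \<mu>" and "\<And>x. \<mu> * (norm x)\<^sup>2 \<le> x \<bullet> (A *v x)"
proof -
  let ?q = "\<lambda>x. x \<bullet> (A *v x)"
  have "\<exists>z\<in>sphere 0 1. \<forall>x\<in>sphere 0 1. ?q z \<le> ?q x"
    by (intro continuous_attains_inf compact_sphere continuous_intros) auto
  then obtain z where z: "norm z = 1" "\<And>x. norm x = 1 \<Longrightarrow> ?q z \<le> ?q x"
    by auto
  have "?q z * (norm x)\<^sup>2 \<le> ?q x" for x
  proof (cases "x = 0")
    case False
    then have "?q z \<le> ?q (x /\<^sub>R norm x)"
      by (intro z(2)) simp
    also have "\<dots> = ?q x / (norm x)\<^sup>2"
      by (simp add: matrix_vector_mult_scaleR power2_eq_square field_simps)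
    finally show ?thesis
      using False by (simp add: field_simps)
  qed simp
  moreover have "0 < ?q z"
    using assms z(1) norm_zero zero_neq_one
    unfolding positive_definite_def inner_sym_part by metis
  ultimately show ?thesis
    using that by blast
qed

lemma linear_error_system: "linear (error_system \<omega> K L M t)"
  by (rule linearI)
    (auto simp: error_system_def cross_add_left cross_mult_left matrix_vector_right_distrib
      matrix_vector_mult_scaleR algebra_simps)

lemma continuous_on_error_system:
  assumes "continuous_on S \<omega>"
  shows "continuous_on S (\<lambda>t. error_system \<omega> K L M t x)"
  unfolding error_system_def
  by (cases x) (auto intro!: continuous_intros continuous_on_cross assms)

text \<open>A linear map whose squared norm is the Lyapunov function \<open>V\<close>; scaling by
  \<open>s\<close> produces the weight \<open>s\<^sup>2\<close>.\<close>

definition gamma_weight ::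
  "real \<Rightarrow> (real^3) \<times> (real^3) \<times> (real^3) \<Rightarrow> (real^3) \<times> (real^3) \<times> (real^3)" where
  "gamma_weight s x = (fst x, s *\<^sub>R fst (snd x), snd (snd x))"

lemma norm_gamma_weight:
  "(norm (gamma_weight s (u, v, w)))\<^sup>2 = (norm u)\<^sup>2 + s\<^sup>2 * (norm v)\<^sup>2 + (norm w)\<^sup>2"
  by (simp add: gamma_weight_def norm_Pair power_mult_distrib add.assoc)

lemma norm_le_norm_gamma_weight:
  assumes "1 \<le> s"
  shows "norm x \<le> norm (gamma_weight s x)"
proof (cases x)
  case (fields u v w)
  have "(norm x)\<^sup>2 = (norm u)\<^sup>2 + 1 * (norm v)\<^sup>2 + (norm w)\<^sup>2"
    by (simp add: fields norm_Pair)
  also have "\<dots> \<le> (norm u)\<^sup>2 + s\<^sup>2 * (norm v)\<^sup>2 + (norm w)\<^sup>2"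
    using assms by (intro add_mono mult_right_mono) auto
  finally show ?thesis
    unfolding fields norm_gamma_weight[symmetric] by (rule power2_le_imp_le) simp
qed

lemma norm_gamma_weight_le:
  assumes "1 \<le> s"
  shows "norm (gamma_weight s x) \<le> s * norm x"
proof (cases x)
  case (fields u v w)
  have "(norm (gamma_weight s x))\<^sup>2 = 1 * (norm u)\<^sup>2 + s\<^sup>2 * (norm v)\<^sup>2 + 1 * (norm w)\<^sup>2"
    by (simp add: fields norm_gamma_weight)
  also have "\<dots> \<le> s\<^sup>2 * (norm u)\<^sup>2 + s\<^sup>2 * (norm v)\<^sup>2 + s\<^sup>2 * (norm w)\<^sup>2"
    using assms by (intro add_mono mult_right_mono) auto
  also have "\<dots> = (s * norm x)\<^sup>2"
    by (simp add: fields norm_Pair power_mult_distrib algebra_simps)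
  finally show ?thesis
    by (rule power2_le_imp_le) (use assms in simp)
qed

lemma bounded_linear_gamma_weight: "bounded_linear (gamma_weight s)"
  unfolding gamma_weight_def[abs_def]
  by (intro bounded_linear_Pair bounded_linear_const_scaleR bounded_linear_fst_comp
      bounded_linear_snd_comp bounded_linear_ident)

text \<open>The matrices dissipate at least \<mu> times the squared weighted norm. The coupling
  consumes at most half of this in the first two components, which leaves the rate
  \<open>\<mu> / 2\<close>.\<close>

lemma error_system_dissipation:
  assumes K: "\<And>x. \<mu> * (norm x)\<^sup>2 \<le> x \<bullet> (K *v x)"
    and L: "\<And>x. \<mu> * (norm x)\<^sup>2 \<le> x \<bullet> (L *v x)"
    and M: "\<And>x. \<mu> * (norm x)\<^sup>2 \<le> x \<bullet> (M *v x)"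
    and "0 < \<mu>" and "1 \<le> s * \<mu>"
  shows "gamma_weight s x \<bullet> gamma_weight s (error_system \<omega> K L M t x)
    \<le> - (\<mu> / 2) * (norm (gamma_weight s x))\<^sup>2"
proof -
  obtain u v w where x: "x = (u, v, w)"
    by (cases x)
  \<comment> \<open>Inserting the factor \<open>s * \<mu>\<close>, which is at least 1, prepares the
    inequality between arithmetic and geometric means for \<open>norm u\<close> and
    \<open>s * norm v\<close>.\<close>
  have "2 * (norm u * norm v) \<le> 2 * (norm u * (s * \<mu> * norm v))"
    using \<open>1 \<le> s * \<mu>\<close> mult_right_mono[of 1 "s * \<mu>" "norm v"] by (simp add: mult_left_mono)
  also have "\<dots> \<le> \<mu> * ((norm u)\<^sup>2 + s\<^sup>2 * (norm v)\<^sup>2)"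
    using \<open>0 < \<mu>\<close> mult_left_mono[OF zero_le_power2[of "norm u - s * norm v"], of \<mu>]
    by (simp add: power2_eq_square algebra_simps)
  finally have "2 * (u \<bullet> v) \<le> \<mu> * ((norm u)\<^sup>2 + s\<^sup>2 * (norm v)\<^sup>2)"
    using norm_cauchy_schwarz[of u v] by simp
  moreover have "s\<^sup>2 * (\<mu> * (norm v)\<^sup>2) \<le> s\<^sup>2 * (v \<bullet> (L *v v))"
    using L by (intro mult_left_mono) auto
  moreover have "gamma_weight s x \<bullet> gamma_weight s (error_system \<omega> K L M t x)
      = u \<bullet> v - u \<bullet> (K *v u) - s\<^sup>2 * (v \<bullet> (L *v v)) - w \<bullet> (M *v w)"
    by (simp add: x gamma_weight_def error_system_def inner_diff_right inner_add_right
        dot_cross_self power2_eq_square algebra_simps)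
  \<comment> \<open>The third component is uncoupled and dissipates at the full rate \<mu>; this
    lets half of its dissipation be dropped.\<close>
  moreover have "0 \<le> \<mu> * (norm w)\<^sup>2"
    using \<open>0 < \<mu>\<close> by simp
  ultimately show ?thesis
    using K[of u] M[of w] unfolding x norm_gamma_weight by (simp add: algebra_simps)
qed

theorem theorem1:
  fixes \<omega> :: "real \<Rightarrow> real^3" and K L M :: "real^3^3"
  assumes "continuous_on {0..} \<omega>"
    and "positive_definite (sym_part K)"
    and "positive_definite (sym_part L)"
    and "positive_definite (sym_part M)"
  shows "globally_exponentially_stable (error_system \<omega> K L M)"
proof -
  obtain k where k: "0 < k" "\<And>x. k * (norm x)\<^sup>2 \<le> x \<bullet> (K *v x)"
    using positive_definite_sym_part_coercive[OF assms(2)] by blast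
  obtain l where l: "0 < l" "\<And>x. l * (norm x)\<^sup>2 \<le> x \<bullet> (L *v x)"
    using positive_definite_sym_part_coercive[OF assms(3)] by blast
  obtain m where m: "0 < m" "\<And>x. m * (norm x)\<^sup>2 \<le> x \<bullet> (M *v x)"
    using positive_definite_sym_part_coercive[OF assms(4)] by blast
  define \<mu> where "\<mu> = min k (min l m)"
  \<comment> \<open>Gives \<open>s * \<mu> = \<mu> + 1\<close>, enough to absorb the coupling, and
    also \<open>1 \<le> s\<close>, as the norm comparisons require.\<close>
  define s where "s = 1 + 1 / \<mu>"
  have "0 < \<mu>"
    using k(1) l(1) m(1) by (simp add: \<mu>_def)
  then have "1 \<le> s" and "1 \<le> s * \<mu>"
    by (auto simp: s_def field_simps)
  have \<mu>: "\<mu> * (norm x)\<^sup>2 \<le> x \<bullet> (K *v x)" "\<mu> * (norm x)\<^sup>2 \<le> x \<bullet> (L *v x)"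
    "\<mu> * (norm x)\<^sup>2 \<le> x \<bullet> (M *v x)" for x
    by (rule order_trans[OF mult_right_mono k(2)] order_trans[OF mult_right_mono l(2)]
        order_trans[OF mult_right_mono m(2)]; simp add: \<mu>_def)+
  \<comment> \<open>The resulting stability constants are the factor \<open>s\<close> and the rate
    \<open>\<mu> / 2\<close>.\<close>
  show ?thesis
  proof (rule globally_exponentially_stable_of_lyapunov)
    show "linear (error_system \<omega> K L M t)" for t
      by (rule linear_error_system)
    show "continuous_on {0..} (\<lambda>t. error_system \<omega> K L M t x)" for x
      by (rule continuous_on_error_system[OF assms(1)])
    show "bounded_linear (gamma_weight s)"
      by (rule bounded_linear_gamma_weight)
    show "norm x \<le> norm (gamma_weight s x)" for x
      by (rule norm_le_norm_gamma_weight[OF \<open>1 \<le> s\<close>])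
    show "norm (gamma_weight s x) \<le> s * norm x" for x
      by (rule norm_gamma_weight_le[OF \<open>1 \<le> s\<close>])
    show "gamma_weight s x \<bullet> gamma_weight s (error_system \<omega> K L M t x)
        \<le> - (\<mu> / 2) * (norm (gamma_weight s x))\<^sup>2" for t x
      by (rule error_system_dissipation[OF \<mu> \<open>0 < \<mu>\<close> \<open>1 \<le> s * \<mu>\<close>])
  qed (use \<open>0 < \<mu>\<close> \<open>1 \<le> s\<close> in auto)
qed

end
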